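(* Let $R$ be a root system of type $A_n$, $B_n$, $C_n$, $D_n$, $F_4$, $E_6$, $E_7$ or $E_8$ (type $G_2$ excluded). Let $G$ be the root lattice, i.e. the additive abelian group generated by the roots in $R$, and let $S\subseteq R$ satisfy $-S=S$. Then the Cayley graph $\mathrm{Cayley}(G,S)$ is Ricci-flat.
   Context: $\mathrm{Cayley}(G,S)$ has vertex set $G$, with $x\sim y$ iff $y-x\in S$. For a vertex $x$ let $\Gamma(x)$ be its neighbors, $d_x=|\Gamma(x)|$, and $d$ the graph distance. For $\alpha\in[0,1]$ let $m_x^\alpha(x)=\alpha$, $m_x^\alpha(v)=\frac{1-\alpha}{d_x}$ for $v\in\Gamma(x)$, $0$ otherwise. $W(m_1,m_2)=\inf_A\sum A(x,y)d(x,y)$ over couplings $A$ of $m_1,m_2$. $\kappa_\alpha(x,y)=1-\frac{W(m_x^\alpha,m_y^\alpha)}{d(x,y)}$, $\kappa(x,y)=\lim_{\alpha\to1}\frac{\kappa_\alpha(x,y)}{1-\alpha}$. A graph is Ricci-flat if $\kappa(x,y)=0$ for every edge $xy$. *)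

theory Defs
  imports "HOL-Analysis.Analysis" "HOL-Computational_Algebra.Group_Closure"
begin

section \<open>Root systems and their types\<close>

definition cartan_int :: "'a::real_inner \<Rightarrow> 'a \<Rightarrow> real" where
  "cartan_int a b = 2 * (a \<bullet> b) / (b \<bullet> b)"

definition root_reflection :: "'a::real_inner \<Rightarrow> 'a \<Rightarrow> 'a" where
  "root_reflection a v = v - cartan_int v a *\<^sub>R a"

text \<open>
  Reduced crystallographic root systems in the Euclidean space \<open>X\<close>. Here \<open>X\<close> may be a proper
  subspace of the ambient space, as for the usual model of \<open>A\<^sub>n\<close> in a hyperplane of
  (n+1)-dimensional space.
\<close>

definition root_system :: "'a::euclidean_space set \<Rightarrow> 'a set \<Rightarrow> bool" where
  "root_system X R \<longleftrightarrow>
     finite R \<and> span R = X \<and> 0 \<notin> R \<and>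
     (\<forall>a\<in>R. \<forall>c::real. c *\<^sub>R a \<in> R \<longrightarrow> c = 1 \<or> c = -1) \<and>
     (\<forall>a\<in>R. \<forall>b\<in>R. root_reflection a b \<in> R) \<and>
     (\<forall>a\<in>R. \<forall>b\<in>R. cartan_int a b \<in> \<int>)"

definition base_of :: "'a::euclidean_space set \<Rightarrow> 'a set \<Rightarrow> nat \<Rightarrow> (nat \<Rightarrow> 'a) \<Rightarrow> bool" where
  "base_of X R n \<alpha> \<longleftrightarrow>
     inj_on \<alpha> {1..n} \<and> \<alpha> ` {1..n} \<subseteq> R \<and>
     independent (\<alpha> ` {1..n}) \<and> span (\<alpha> ` {1..n}) = X \<and>
     (\<forall>b\<in>R. \<exists>k :: nat \<Rightarrow> nat. b = (\<Sum>i=1..n. real (k i) *\<^sub>R \<alpha> i) \<or>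
                                b = - (\<Sum>i=1..n. real (k i) *\<^sub>R \<alpha> i))"

datatype dynkin_type =
    TypeA nat | TypeB nat | TypeC nat | TypeD nat | TypeE6 | TypeE7 | TypeE8 | TypeF4 | TypeG2

fun dynkin_rank :: "dynkin_type \<Rightarrow> nat" where
  "dynkin_rank (TypeA n) = n"
| "dynkin_rank (TypeB n) = n"
| "dynkin_rank (TypeC n) = n"
| "dynkin_rank (TypeD n) = n"
| "dynkin_rank TypeE6 = 6"
| "dynkin_rank TypeE7 = 7"
| "dynkin_rank TypeE8 = 8"
| "dynkin_rank TypeF4 = 4"
| "dynkin_rank TypeG2 = 2"

text \<open>The coincidences \<open>C\<^sub>2 = B\<^sub>2\<close> and \<open>D\<^sub>3 = A\<^sub>3\<close> are allowed.\<close>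

fun dynkin_valid :: "dynkin_type \<Rightarrow> bool" where
  "dynkin_valid (TypeA n) \<longleftrightarrow> n \<ge> 1"
| "dynkin_valid (TypeB n) \<longleftrightarrow> n \<ge> 2"
| "dynkin_valid (TypeC n) \<longleftrightarrow> n \<ge> 2"
| "dynkin_valid (TypeD n) \<longleftrightarrow> n \<ge> 3"
| "dynkin_valid _ \<longleftrightarrow> True"

text \<open>
  Bonds \<open>{i, j}\<close> with \<open>i < j\<close> of the Dynkin diagram on the nodes \<open>1, \<dots>, n\<close>, in Bourbaki's
  numbering. Multiplicities and arrows are recorded separately.
\<close>

definition bond_E :: "nat \<Rightarrow> nat \<Rightarrow> bool" where
  "bond_E i j \<longleftrightarrow> (i = 1 \<and> j = 3) \<or> (i = 2 \<and> j = 4) \<or> (3 \<le> i \<and> j = Suc i)"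

fun dynkin_bond :: "dynkin_type \<Rightarrow> nat \<Rightarrow> nat \<Rightarrow> bool" where
  "dynkin_bond (TypeD n) i j \<longleftrightarrow> (j = Suc i \<and> j < n) \<or> (Suc (Suc i) = n \<and> j = n)"
| "dynkin_bond TypeE6 i j \<longleftrightarrow> bond_E i j"
| "dynkin_bond TypeE7 i j \<longleftrightarrow> bond_E i j"
| "dynkin_bond TypeE8 i j \<longleftrightarrow> bond_E i j"
| "dynkin_bond _ i j \<longleftrightarrow> j = Suc i"

text \<open>
  The entry at a bond \<open>(i, j)\<close> is \<open>-1\<close>, unless the bond is multiple and node \<open>i\<close> is its long end;
  then it is minus the multiplicity (entries are \<open>2 (\<alpha>\<^sub>i \<bullet> \<alpha>\<^sub>j) / (\<alpha>\<^sub>j \<bullet> \<alpha>\<^sub>j)\<close>).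
\<close>

fun bond_entry :: "dynkin_type \<Rightarrow> nat \<Rightarrow> nat \<Rightarrow> int" where
  "bond_entry (TypeB n) i j = (if Suc i = n \<and> j = n then -2 else -1)"
| "bond_entry (TypeC n) i j = (if i = n \<and> Suc j = n then -2 else -1)"
| "bond_entry TypeF4 i j = (if i = 2 \<and> j = 3 then -2 else -1)"
| "bond_entry TypeG2 i j = (if i = 2 \<and> j = 1 then -3 else -1)"
| "bond_entry _ i j = -1"

definition cartan_matrix :: "dynkin_type \<Rightarrow> nat \<Rightarrow> nat \<Rightarrow> int" where
  "cartan_matrix T i j =
     (if i = j then 2
      else if dynkin_bond T i j \<or> dynkin_bond T j i then bond_entry T i j
      else 0)"

definition root_system_of_type ::
    "dynkin_type \<Rightarrow> 'a::euclidean_space set \<Rightarrow> 'a set \<Rightarrow> bool" where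
  "root_system_of_type T X R \<longleftrightarrow>
     dynkin_valid T \<and> root_system X R \<and>
     (\<exists>\<alpha>. base_of X R (dynkin_rank T) \<alpha> \<and>
          (\<forall>i\<in>{1..dynkin_rank T}. \<forall>j\<in>{1..dynkin_rank T}.
             cartan_int (\<alpha> i) (\<alpha> j) = of_int (cartan_matrix T i j)))"

definition root_lattice :: "'a::euclidean_space set \<Rightarrow> 'a set" where
  "root_lattice R = group_closure R"

section \<open>Ricci curvature of graphs\<close>

text \<open>
  A graph is given by its vertex set \<open>V\<close> and its (symmetric) adjacency relation \<open>E\<close>.
\<close>

definition cayley_adj :: "'a::ab_group_add set \<Rightarrow> 'a set \<Rightarrow> ('a \<times> 'a) set" where
  "cayley_adj G S = {(x, y). x \<in> G \<and> y \<in> G \<and> y - x \<in> S}"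

definition nbrs :: "('v \<times> 'v) set \<Rightarrow> 'v \<Rightarrow> 'v set" where
  "nbrs E x = {y. (x, y) \<in> E}"

text \<open>
  The value is unspecified for vertices in different components. Such pairs do not contribute to
  the curvature of an edge: both measures then live in the component of that edge.
\<close>

definition gdist :: "('v \<times> 'v) set \<Rightarrow> 'v \<Rightarrow> 'v \<Rightarrow> nat" where
  "gdist E x y = (LEAST n. (x, y) \<in> E ^^ n)"

definition walk_measure :: "('v \<times> 'v) set \<Rightarrow> real \<Rightarrow> 'v \<Rightarrow> 'v \<Rightarrow> real" where
  "walk_measure E \<alpha> x v =
     (if v = x then \<alpha>
      else if v \<in> nbrs E x then (1 - \<alpha>) / real (card (nbrs E x))
      else 0)"

definition coupling :: "'v set \<Rightarrow> ('v \<Rightarrow> real) \<Rightarrow> ('v \<Rightarrow> real) \<Rightarrow> ('v \<Rightarrow> 'v \<Rightarrow> real) \<Rightarrow> bool" where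
  "coupling V m1 m2 A \<longleftrightarrow>
     (\<forall>x\<in>V. \<forall>y\<in>V. 0 \<le> A x y) \<and>
     (\<forall>x\<in>V. ((\<lambda>y. A x y) has_sum m1 x) V) \<and>
     (\<forall>y\<in>V. ((\<lambda>x. A x y) has_sum m2 y) V)"

definition transport_cost :: "'v set \<Rightarrow> ('v \<times> 'v) set \<Rightarrow> ('v \<Rightarrow> 'v \<Rightarrow> real) \<Rightarrow> real" where
  "transport_cost V E A = (\<Sum>\<^sub>\<infinity>(x, y)\<in>V \<times> V. A x y * real (gdist E x y))"

definition wasserstein ::
    "'v set \<Rightarrow> ('v \<times> 'v) set \<Rightarrow> ('v \<Rightarrow> real) \<Rightarrow> ('v \<Rightarrow> real) \<Rightarrow> real" where
  "wasserstein V E m1 m2 = Inf {transport_cost V E A | A. coupling V m1 m2 A}"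

definition ricci_alpha :: "'v set \<Rightarrow> ('v \<times> 'v) set \<Rightarrow> real \<Rightarrow> 'v \<Rightarrow> 'v \<Rightarrow> real" where
  "ricci_alpha V E \<alpha> x y =
     1 - wasserstein V E (walk_measure E \<alpha> x) (walk_measure E \<alpha> y) / real (gdist E x y)"

text \<open>The limit defining the curvature is required to exist.\<close>

definition has_ricci_curvature ::
    "'v set \<Rightarrow> ('v \<times> 'v) set \<Rightarrow> 'v \<Rightarrow> 'v \<Rightarrow> real \<Rightarrow> bool" where
  "has_ricci_curvature V E x y k \<longleftrightarrow>
     ((\<lambda>\<alpha>. ricci_alpha V E \<alpha> x y / (1 - \<alpha>)) \<longlongrightarrow> k) (at_left 1)"

definition ricci_flat :: "'v set \<Rightarrow> ('v \<times> 'v) set \<Rightarrow> bool" where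
  "ricci_flat V E \<longleftrightarrow> (\<forall>(x, y)\<in>E. has_ricci_curvature V E x y 0)"

end

theory Submission
  imports Defs
begin

text \<open>
  Fix an edge from \<open>x\<close> to \<open>x + s\<close>. Translation by \<open>s\<close> carries the walk measure at \<open>x\<close> to the one
  at \<open>x + s\<close>, at transport cost at most 1. Conversely, the linear functional
  \<open>f v = (v \<bullet> s) / (s \<bullet> s)\<close> satisfies \<open>f s = 1\<close> and \<open>f t = cartan_int t s / 2\<close>, so it is 1-Lipschitz
  for the graph distance as soon as no Cartan integer exceeds 2; by duality every coupling then
  costs at least 1. Outside type \<open>G\<^sub>2\<close> the simple roots have squared lengths in \<open>{c, 2 c}\<close>, and each
  root has the length of a simple root, so Cauchy-Schwarz bounds the squares of the Cartan
  integers by 8.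
\<close>

section \<open>Abelian Cayley graphs\<close>

locale abelian_cayley =
  fixes G S :: "'a::ab_group_add set"
  assumes add_closed: "\<And>x y. x \<in> G \<Longrightarrow> y \<in> G \<Longrightarrow> x + y \<in> G"
    and diff_closed: "\<And>x y. x \<in> G \<Longrightarrow> y \<in> G \<Longrightarrow> x - y \<in> G"
    and gens_subset: "S \<subseteq> G"
    and finite_gens: "finite S"
    and zero_notin_gens: "0 \<notin> S"
    and gens_sym: "uminus ` S = S"
begin

section \<open>Neighbourhoods and walk measures\<close>

abbreviation E where "E \<equiv> cayley_adj G S"

text \<open>A finite set carrying \<open>walk_measure E \<alpha> x\<close> when
  \<open>x \<in> G\<close>; restricting to it turns sums over a possibly infinite \<open>G\<close>
  into finite ones.\<close>

definition star :: "'a \<Rightarrow> 'a set" where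
  "star x = insert x (nbrs E x)"

lemma uminus_gens: "t \<in> S \<Longrightarrow> - t \<in> S"
  using gens_sym by blast

lemma edge_translate: "x \<in> G \<Longrightarrow> t \<in> S \<Longrightarrow> (x, x + t) \<in> E"
  using add_closed gens_subset by (auto simp: cayley_adj_def)

lemma nbrs_eq: "x \<in> G \<Longrightarrow> nbrs E x = (\<lambda>t. x + t) ` S"
  using edge_translate by (force simp: nbrs_def cayley_adj_def image_iff)

lemma card_nbrs: "x \<in> G \<Longrightarrow> card (nbrs E x) = card S"
  by (simp add: nbrs_eq card_image)

lemma finite_star: "x \<in> G \<Longrightarrow> finite (star x)"
  by (simp add: star_def nbrs_eq finite_gens)

lemma star_subset: "x \<in> G \<Longrightarrow> star x \<subseteq> G"
  by (auto simp: star_def nbrs_def cayley_adj_def)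

lemma self_notin_nbrs: "x \<in> G \<Longrightarrow> x \<notin> nbrs E x"
  using zero_notin_gens by (simp add: nbrs_def cayley_adj_def)

lemma edge_sym: "(x, y) \<in> E \<Longrightarrow> (y, x) \<in> E"
  using uminus_gens[of "y - x"] by (simp add: cayley_adj_def)

text \<open>\<open>S\<close> may fail to generate \<open>G\<close>, and \<open>gdist\<close> is
  meaningful only inside a component. This makes every distance between the two supports a genuine
  one.\<close>

lemma star_connected:
  assumes "(x, y) \<in> E" "u \<in> star x" "v \<in> star y"
  shows "(u, v) \<in> E\<^sup>*"
proof -
  have "(u, x) \<in> E\<^sup>*" "(y, v) \<in> E\<^sup>*"
    using assms edge_sym by (auto simp: star_def nbrs_def)
  then show ?thesis using assms(1) by (meson rtrancl.rtrancl_into_rtrancl rtrancl_trans)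
qed

lemma walk_measure_outside: "v \<notin> star x \<Longrightarrow> walk_measure E \<alpha> x v = 0"
  by (auto simp: walk_measure_def star_def)

lemma walk_measure_nonneg: "0 \<le> \<alpha> \<Longrightarrow> \<alpha> \<le> 1 \<Longrightarrow> 0 \<le> walk_measure E \<alpha> x v"
  by (simp add: walk_measure_def)

lemma walk_measure_total:
  assumes "x \<in> G" "S \<noteq> {}"
  shows "(\<Sum>v\<in>star x. walk_measure E \<alpha> x v) = 1"
proof -
  have "card S > 0" using assms finite_gens by (simp add: card_gt_0_iff)
  moreover have "(\<Sum>v\<in>nbrs E x. walk_measure E \<alpha> x v) = (\<Sum>v\<in>nbrs E x. (1 - \<alpha>) / real (card S))"
    using self_notin_nbrs[OF assms(1)]
    by (intro sum.cong) (auto simp: walk_measure_def card_nbrs assms)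
  ultimately show ?thesis
    using self_notin_nbrs[OF assms(1)] finite_star[OF assms(1)]
    by (simp add: star_def walk_measure_def card_nbrs assms)
qed

text \<open>Translation by an element of \<open>G\<close> is an automorphism of the Cayley
  graph.\<close>

lemma walk_measure_translate:
  assumes "x \<in> G" "s \<in> G" "v \<in> G"
  shows "walk_measure E \<alpha> (x + s) (v + s) = walk_measure E \<alpha> x v"
proof -
  have "v + s \<in> nbrs E (x + s) \<longleftrightarrow> v \<in> nbrs E x"
    using assms add_closed by (auto simp: nbrs_def cayley_adj_def)
  then show ?thesis
    using assms add_closed by (simp add: walk_measure_def card_nbrs)
qed

lemma star_translate:
  assumes "x \<in> G" "s \<in> G"
  shows "star (x + s) = (\<lambda>v. v + s) ` star x"
  using assms add_closed by (auto simp: star_def nbrs_eq image_image algebra_simps)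

section \<open>Lower bound for the transport cost by duality\<close>

text \<open>Each edge of a walk adds an element of \<open>S\<close>, which raises \<open>f\<close>
  by at most 1, and the increments telescope. Connectedness ensures that the \<open>LEAST\<close> in
  \<open>gdist\<close> is attained.\<close>

lemma lipschitz_le_gdist:
  fixes f :: "'a \<Rightarrow> real"
  assumes add: "\<And>a b. f (a + b) = f a + f b" and le: "\<And>t. t \<in> S \<Longrightarrow> f t \<le> 1"
    and "(u, v) \<in> E\<^sup>*"
  shows "f v - f u \<le> real (gdist E u v)"
proof -
  have walk: "f w - f u \<le> real n" if "(u, w) \<in> E ^^ n" for n w
    using that
  proof (induction n arbitrary: w)
    case (Suc n)
    then obtain z where z: "(u, z) \<in> E ^^ n" "(z, w) \<in> E" by auto
    have "f w - f z \<le> 1"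
      using le[of "w - z"] add[of z "w - z"] z(2) by (simp add: cayley_adj_def)
    with Suc.IH[OF z(1)] show ?case by simp
  qed simp
  have "(u, v) \<in> E ^^ gdist E u v"
    using assms(3) unfolding gdist_def by (metis LeastI rtrancl_imp_relpow)
  then show ?thesis by (rule walk)
qed

text \<open>A row or column of nonnegative entries with sum 0 vanishes termwise.\<close>

lemma coupling_support:
  assumes "coupling G m1 m2 A" "u \<in> G" "v \<in> G" "m1 u = 0 \<or> m2 v = 0"
  shows "A u v = 0"
  using assms(4)
proof
  assume "m1 u = 0"
  with assms have "((\<lambda>w. A u w) has_sum 0) G" "\<And>w. w \<in> G \<Longrightarrow> 0 \<le> A u w"
    by (auto simp: coupling_def)
  then show ?thesis
    using assms(3) by (intro nonneg_has_sum_le_0D[where f = "\<lambda>w. A u w" and A = G and a = 0]) auto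
next
  assume "m2 v = 0"
  with assms have "((\<lambda>w. A w v) has_sum 0) G" "\<And>w. w \<in> G \<Longrightarrow> 0 \<le> A w v"
    by (auto simp: coupling_def)
  then show ?thesis
    using assms(2) by (intro nonneg_has_sum_le_0D[where f = "\<lambda>w. A w v" and A = G and a = 0]) auto
qed

text \<open>The easy half of Kantorovich duality: replacing the distance by \<open>f v - f u\<close>
  bounds the cost below by the difference of the integrals of \<open>f\<close> against the
  marginals. The second marginal is the first one translated by \<open>s\<close>, so additivity of
  \<open>f\<close> makes this difference \<open>f s\<close>.\<close>

lemma transport_cost_ge:
  fixes f :: "'a \<Rightarrow> real"
  assumes add: "\<And>a b. f (a + b) = f a + f b" and le: "\<And>t. t \<in> S \<Longrightarrow> f t \<le> 1"
    and x: "x \<in> G" and s: "s \<in> S"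
    and A: "coupling G (walk_measure E \<alpha> x) (walk_measure E \<alpha> (x + s)) A"
  shows "f s \<le> transport_cost G E A"
proof -
  define y where "y = x + s"
  let ?mx = "walk_measure E \<alpha> x" and ?my = "walk_measure E \<alpha> y"
  have A': "coupling G ?mx ?my A" using A by (simp add: y_def)
  have sG: "s \<in> G" using s gens_subset by blast
  have y: "y \<in> G" using x sG add_closed by (simp add: y_def)
  have xy: "(x, y) \<in> E" using edge_translate[OF x s] by (simp add: y_def)
  note sub = star_subset[OF x] star_subset[OF y] and fin = finite_star[OF x] finite_star[OF y]
  have zero: "A u v = 0" if "u \<in> G" "v \<in> G" "u \<notin> star x \<or> v \<notin> star y" for u v
    using coupling_support[OF A' that(1,2)] walk_measure_outside that(3) by blast
  have row: "(\<Sum>v\<in>star y. A u v) = ?mx u" if "u \<in> star x" for u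
  proof -
    have "((\<lambda>v. A u v) has_sum ?mx u) G"
      using A' that sub by (auto simp: coupling_def)
    then have "((\<lambda>v. A u v) has_sum ?mx u) (star y)"
      by (rule has_sum_cong_neutral[THEN iffD1, rotated -1]) (use zero that sub in auto)
    then show ?thesis using fin by (simp add: has_sum_finite_iff)
  qed
  have col: "(\<Sum>u\<in>star x. A u v) = ?my v" if "v \<in> star y" for v
  proof -
    have "((\<lambda>u. A u v) has_sum ?my v) G"
      using A' that sub by (auto simp: coupling_def)
    then have "((\<lambda>u. A u v) has_sum ?my v) (star x)"
      by (rule has_sum_cong_neutral[THEN iffD1, rotated -1]) (use zero that sub in auto)
    then show ?thesis using fin by (simp add: has_sum_finite_iff)
  qed
  have "transport_cost G E A = (\<Sum>\<^sub>\<infinity>(u, v)\<in>star x \<times> star y. A u v * real (gdist E u v))"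
    unfolding transport_cost_def
    by (rule infsum_cong_neutral) (use zero sub in \<open>fastforce+\<close>)
  also have "\<dots> = (\<Sum>u\<in>star x. \<Sum>v\<in>star y. A u v * real (gdist E u v))"
    using fin by (simp add: sum.cartesian_product)
  also have "\<dots> \<ge> (\<Sum>u\<in>star x. \<Sum>v\<in>star y. A u v * (f v - f u))"
  proof (intro sum_mono mult_left_mono)
    fix u v assume uv: "u \<in> star x" "v \<in> star y"
    show "f v - f u \<le> real (gdist E u v)"
      using lipschitz_le_gdist[OF add le star_connected[OF xy uv]] by blast
    show "0 \<le> A u v" using A' uv sub by (auto simp: coupling_def)
  qed
  also have "(\<Sum>u\<in>star x. \<Sum>v\<in>star y. A u v * (f v - f u))
      = (\<Sum>v\<in>star y. (\<Sum>u\<in>star x. A u v) * f v) - (\<Sum>u\<in>star x. (\<Sum>v\<in>star y. A u v) * f u)"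
    by (simp add: right_diff_distrib sum_subtractf sum_distrib_right)
       (rule sum.swap)
  also have "\<dots> = (\<Sum>v\<in>star y. ?my v * f v) - (\<Sum>u\<in>star x. ?mx u * f u)"
    by (simp add: row col)
  also have "(\<Sum>v\<in>star y. ?my v * f v) = (\<Sum>u\<in>star x. ?my (u + s) * f (u + s))"
    unfolding y_def star_translate[OF x sG] by (subst sum.reindex) auto
  also have "\<dots> = (\<Sum>u\<in>star x. ?mx u * f u + ?mx u * f s)"
    using walk_measure_translate[OF x sG] sub
    by (intro sum.cong) (auto simp: y_def add distrib_left)
  \<comment> \<open>The constant \<open>f s\<close> is weighted by the total mass 1;
    \<open>s\<close> witnesses that \<open>S\<close> is nonempty.\<close>
  also have "\<dots> = (\<Sum>u\<in>star x. ?mx u * f u) + f s"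
    using walk_measure_total[OF x, of \<alpha>] s
    by (auto simp: sum.distrib simp flip: sum_distrib_right)
  finally show ?thesis by simp
qed

section \<open>Upper bound by the translation coupling\<close>

text \<open>All mass is moved rigidly by \<open>s\<close>, hence across a single edge; the second
  marginal is correct by \<open>walk_measure_translate\<close>.\<close>

lemma translation_coupling:
  assumes x: "x \<in> G" and s: "s \<in> S" and \<alpha>: "0 \<le> \<alpha>" "\<alpha> \<le> 1"
  defines "A \<equiv> (\<lambda>u v. if v = u + s then walk_measure E \<alpha> x u else 0)"
  shows "coupling G (walk_measure E \<alpha> x) (walk_measure E \<alpha> (x + s)) A"
    and "transport_cost G E A \<le> 1"
proof -
  let ?mx = "walk_measure E \<alpha> x"
  have sG: "s \<in> G" using s gens_subset by blast
  have row: "((\<lambda>v. A u v) has_sum ?mx u) G" if "u \<in> G" for u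
  proof -
    have "((\<lambda>v. A u v) has_sum ?mx u) {u + s}" by (simp add: has_sum_finite_iff A_def)
    then show ?thesis
      by (rule has_sum_cong_neutral[THEN iffD1, rotated -1])
         (use that sG add_closed in \<open>auto simp: A_def\<close>)
  qed
  have col: "((\<lambda>u. A u v) has_sum walk_measure E \<alpha> (x + s) v) G" if "v \<in> G" for v
  proof -
    have "((\<lambda>u. A u v) has_sum ?mx (v - s)) {v - s}" by (simp add: has_sum_finite_iff A_def)
    then have "((\<lambda>u. A u v) has_sum ?mx (v - s)) G"
      by (rule has_sum_cong_neutral[THEN iffD1, rotated -1])
         (use that sG diff_closed in \<open>auto simp: A_def\<close>)
    then show ?thesis
      using walk_measure_translate[OF x sG diff_closed[OF that sG], of \<alpha>] by simp
  qed
  show "coupling G ?mx (walk_measure E \<alpha> (x + s)) A"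
    unfolding coupling_def using row col walk_measure_nonneg[OF \<alpha>] by (simp add: A_def)
  have inj: "inj_on (\<lambda>u. (u, u + s)) (star x)" by (simp add: inj_on_def)
  have "transport_cost G E A =
      (\<Sum>\<^sub>\<infinity>(u, v)\<in>(\<lambda>u. (u, u + s)) ` star x. A u v * real (gdist E u v))"
    unfolding transport_cost_def
    by (rule infsum_cong_neutral)
       (use star_subset[OF x] sG add_closed walk_measure_outside in \<open>auto simp: A_def image_iff\<close>)
  also have "\<dots> = (\<Sum>u\<in>star x. ?mx u * real (gdist E u (u + s)))"
    using finite_star[OF x] by (simp add: sum.reindex[OF inj] A_def)
  also have "\<dots> \<le> (\<Sum>u\<in>star x. ?mx u * 1)"
  proof (intro sum_mono mult_left_mono walk_measure_nonneg \<alpha>)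
    fix u assume "u \<in> star x"
    then have "(u, u + s) \<in> E ^^ 1" using star_subset[OF x] edge_translate s by auto
    then have "gdist E u (u + s) \<le> 1" unfolding gdist_def by (rule Least_le)
    then show "real (gdist E u (u + s)) \<le> 1" by simp
  qed
  also have "\<dots> = 1" using walk_measure_total[OF x] s by auto
  finally show "transport_cost G E A \<le> 1" .
qed

section \<open>Flatness from additive Lipschitz functions\<close>

text \<open>The two bounds pin the Wasserstein distance across an edge to 1 for every
  \<open>\<alpha>\<close> in [0, 1], so the quotient defining the curvature vanishes even before the
  limit. The function \<open>f\<close> may depend on the direction \<open>s\<close> of the
  edge.\<close>

theorem ricci_flat_if_lipschitz:
  assumes ex: "\<And>s. s \<in> S \<Longrightarrow> \<exists>f :: 'a \<Rightarrow> real.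
    (\<forall>a b. f (a + b) = f a + f b) \<and> (\<forall>t\<in>S. f t \<le> 1) \<and> f s = 1"
  shows "ricci_flat G E"
  unfolding ricci_flat_def
proof safe
  fix x y assume xy: "(x, y) \<in> E"
  define s where "s = y - x"
  have s: "s \<in> S" and x: "x \<in> G" and y: "y = x + s"
    using xy by (auto simp: cayley_adj_def s_def)
  obtain f :: "'a \<Rightarrow> real" where add: "\<And>a b. f (a + b) = f a + f b"
    and le: "\<And>t. t \<in> S \<Longrightarrow> f t \<le> 1" and fs: "f s = 1"
    using ex[OF s] by blast
  have "gdist E x y = 1"
    unfolding gdist_def
  proof (rule Least_equality)
    show "(x, y) \<in> E ^^ 1" using xy by simp
    have "y \<noteq> x" using s zero_notin_gens by (auto simp: s_def)
    then show "1 \<le> n" if "(x, y) \<in> E ^^ n" for n using that by (cases n) auto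
  qed
  have W: "wasserstein G E (walk_measure E \<alpha> x) (walk_measure E \<alpha> y) = 1"
    if \<alpha>: "0 \<le> \<alpha>" "\<alpha> \<le> 1" for \<alpha>
    unfolding wasserstein_def
  proof (rule antisym)
    let ?C = "{transport_cost G E A |A. coupling G (walk_measure E \<alpha> x) (walk_measure E \<alpha> y) A}"
    have ge: "1 \<le> c" if "c \<in> ?C" for c
      using that transport_cost_ge[OF add le x s] fs by (auto simp: y)
    obtain c where c: "c \<in> ?C" "c \<le> 1"
      using translation_coupling[OF x s \<alpha>] unfolding y by blast
    \<comment> \<open>A real \<open>Inf\<close> is informative only for a nonempty set bounded
      below: \<open>c\<close> and \<open>ge\<close> provide this.\<close>
    have "bdd_below ?C" using ge by (rule bdd_belowI)
    with c show "Inf ?C \<le> 1" by (meson cInf_lower order_trans)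
    show "1 \<le> Inf ?C" using c(1) ge by (intro cInf_greatest) auto
  qed
  have "\<forall>\<^sub>F \<alpha> in at_left (1::real). 0 < \<alpha> \<and> \<alpha> < 1"
    unfolding eventually_at_left_field by (intro exI[of _ 0]) auto
  then have "\<forall>\<^sub>F \<alpha> in at_left 1. ricci_alpha G E \<alpha> x y / (1 - \<alpha>) = 0"
    by (rule eventually_mono) (simp add: ricci_alpha_def W \<open>gdist E x y = 1\<close>)
  then show "has_ricci_curvature G E x y 0"
    unfolding has_ricci_curvature_def by (rule tendsto_eventually)
qed

end

section \<open>Root lengths\<close>

lemma independent_sum_inj:
  fixes \<alpha> :: "nat \<Rightarrow> 'a::real_vector"
  assumes "inj_on \<alpha> I" "finite I" "independent (\<alpha> ` I)"
    and "(\<Sum>i\<in>I. k i *\<^sub>R \<alpha> i) = (\<Sum>i\<in>I. l i *\<^sub>R \<alpha> i)" "j \<in> I"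
  shows "k j = l j"
proof -
  \<comment> \<open>Independence speaks of a set of vectors, so the coefficient differences are
    carried from indices to vectors along the injective \<open>\<alpha>\<close>.\<close>
  define u where "u v = (k (the_inv_into I \<alpha> v) - l (the_inv_into I \<alpha> v))" for v
  have "(\<Sum>v\<in>\<alpha> ` I. u v *\<^sub>R v) = (\<Sum>i\<in>I. (k i - l i) *\<^sub>R \<alpha> i)"
    using assms(1) by (simp add: sum.reindex u_def the_inv_into_f_f)
  also have "\<dots> = 0" using assms(4) by (simp add: scaleR_diff_left sum_subtractf)
  finally have "u (\<alpha> j) = 0"
    using assms(2,3,5) independentD[of "\<alpha> ` I" "\<alpha> ` I" u "\<alpha> j"] by auto
  then show ?thesis using assms(1,5) by (simp add: u_def the_inv_into_f_f)
qed

text \<open>With \<open>c = cartan_int v a\<close>, the cross term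
  \<open>2 * c * (v \<bullet> a)\<close> cancels against
  \<open>c * c * (a \<bullet> a)\<close>.\<close>

lemma inner_root_reflection:
  assumes "a \<noteq> 0"
  shows "root_reflection a v \<bullet> root_reflection a v = v \<bullet> v"
  using assms
  by (simp add: root_reflection_def cartan_int_def inner_diff_left inner_diff_right
      inner_commute field_simps power2_eq_square)

text \<open>
  A positive non-simple root has positive inner product with some simple root; the corresponding
  reflection preserves its length and lowers its height.
\<close>

lemma positive_root_length:
  assumes R: "root_system X R" and B: "base_of X R n \<alpha>"
    and "(\<Sum>i=1..n. real (k i) *\<^sub>R \<alpha> i) \<in> R"
  shows "\<exists>i\<in>{1..n}. (\<Sum>i=1..n. real (k i) *\<^sub>R \<alpha> i) \<bullet> (\<Sum>i=1..n. real (k i) *\<^sub>R \<alpha> i) = \<alpha> i \<bullet> \<alpha> i"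
  using assms(3)
proof (induction "\<Sum>i=1..n. k i" arbitrary: k rule: less_induct)
  case less
  define b where "b = (\<Sum>i=1..n. real (k i) *\<^sub>R \<alpha> i)"
  have bR: "b \<in> R" using less.prems by (simp add: b_def)
  then have "b \<noteq> 0" using R by (auto simp: root_system_def)
  then have "0 < b \<bullet> b" by simp
  also have "b \<bullet> b = (\<Sum>i=1..n. real (k i) * (\<alpha> i \<bullet> b))"
    by (subst (1) b_def) (simp add: inner_sum_left)
  finally obtain i where i: "i \<in> {1..n}" and pos: "0 < real (k i) * (\<alpha> i \<bullet> b)"
    by (meson not_less sum_nonpos)
  have ip: "0 < \<alpha> i \<bullet> b" using pos by (simp add: zero_less_mult_iff)
  have iR: "\<alpha> i \<in> R" using B i by (auto simp: base_of_def)
  then have i0: "\<alpha> i \<noteq> 0" using R by (auto simp: root_system_def)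
  have "0 < cartan_int b (\<alpha> i)" using ip i0 by (simp add: cartan_int_def inner_commute)
  moreover have "cartan_int b (\<alpha> i) \<in> \<int>" using R bR iR by (simp add: root_system_def)
  ultimately obtain p :: nat where p: "cartan_int b (\<alpha> i) = real p" "p > 0"
    by (metis Ints_cases of_int_0_less_iff of_int_of_nat_eq of_nat_0_less_iff zero_less_imp_eq_int)
  define b' where "b' = root_reflection (\<alpha> i) b"
  \<comment> \<open>The reflection changes only the coordinate at \<open>i\<close>, lowering it by
    \<open>p\<close>.\<close>
  have b': "b' = (\<Sum>j=1..n. (real (k j) - (if j = i then real p else 0)) *\<^sub>R \<alpha> j)"
    using i by (simp add: b'_def root_reflection_def p scaleR_diff_left sum_subtractf
        if_distrib[of "\<lambda>c. c *\<^sub>R _"] b_def[unfolded One_nat_def, symmetric] cong: if_cong)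
  have b'R: "b' \<in> R" using R bR iR by (simp add: root_system_def b'_def)
  have norm: "b' \<bullet> b' = b \<bullet> b" using inner_root_reflection[OF i0] by (simp add: b'_def)
  have inj: "inj_on \<alpha> {1..n}" "independent (\<alpha> ` {1..n})" using B by (auto simp: base_of_def)
  obtain l :: "nat \<Rightarrow> nat" where "b' = (\<Sum>j=1..n. real (l j) *\<^sub>R \<alpha> j) \<or>
      b' = - (\<Sum>j=1..n. real (l j) *\<^sub>R \<alpha> j)"
    using B b'R unfolding base_of_def by blast
  then show ?case
  proof
    assume l: "b' = (\<Sum>j=1..n. real (l j) *\<^sub>R \<alpha> j)"
    have lk: "real (l j) = real (k j) - (if j = i then real p else 0)" if "j \<in> {1..n}" for j
      by (rule independent_sum_inj[OF inj(1) _ inj(2) _ that]) (use l b' in simp_all)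
    have "(\<Sum>j=1..n. l j) < (\<Sum>j=1..n. k j)"
    proof (rule sum_strict_mono_ex1)
      show "\<forall>j\<in>{1..n}. l j \<le> k j"
      proof
        fix j assume "j \<in> {1..n}"
        from lk[OF this] show "l j \<le> k j" by (simp split: if_splits)
      qed
      show "\<exists>j\<in>{1..n}. l j < k j" using lk[OF i] p(2) i by (intro bexI[of _ i]) simp_all
    qed simp
    from less.hyps[OF this] b'R have "\<exists>i\<in>{1..n}. b' \<bullet> b' = \<alpha> i \<bullet> \<alpha> i"
      unfolding l by blast
    then show ?thesis unfolding norm b_def .
  next
    assume "b' = - (\<Sum>j=1..n. real (l j) *\<^sub>R \<alpha> j)"
    then have l: "b' = (\<Sum>j=1..n. (- real (l j)) *\<^sub>R \<alpha> j)" by (simp add: sum_negf)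
    have lk: "- real (l j) = real (k j) - (if j = i then real p else 0)" if "j \<in> {1..n}" for j
      by (rule independent_sum_inj[OF inj(1) _ inj(2) _ that, where k = "\<lambda>j. - real (l j)"])
         (use l b' in simp_all)
    \<comment> \<open>Here \<open>lk\<close> equates a nonpositive with a nonnegative number, so
      \<open>b\<close> is a multiple of the simple root \<open>\<alpha> i\<close>.\<close>
    have "k j = 0" if "j \<in> {1..n}" "j \<noteq> i" for j using lk[OF that(1)] that(2) by simp
    then have "b = (\<Sum>j=1..n. if j = i then real (k i) *\<^sub>R \<alpha> i else 0)"
      unfolding b_def by (intro sum.cong) auto
    then have "b = real (k i) *\<^sub>R \<alpha> i" using i by simp
    \<comment> \<open>Reducedness of the root system; the value -1 is then excluded because
      \<open>k i\<close> is a natural number.\<close>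
    moreover from this have "real (k i) = 1 \<or> real (k i) = -1"
      using R iR bR unfolding root_system_def by metis
    ultimately have "b = \<alpha> i" by auto
    then show ?thesis using i unfolding b_def by metis
  qed
qed

lemma root_length_simple:
  assumes "root_system X R" "base_of X R n \<alpha>" "b \<in> R"
  shows "\<exists>i\<in>{1..n}. b \<bullet> b = \<alpha> i \<bullet> \<alpha> i"
proof -
  obtain k :: "nat \<Rightarrow> nat" where k: "b = (\<Sum>i=1..n. real (k i) *\<^sub>R \<alpha> i) \<or>
      b = - (\<Sum>i=1..n. real (k i) *\<^sub>R \<alpha> i)"
    using assms(2,3) unfolding base_of_def by blast
  define c where "c = (\<Sum>i=1..n. real (k i) *\<^sub>R \<alpha> i)"
  \<comment> \<open>Roots are closed under negation, so a negative root may be replaced by its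
    positive opposite of the same length.\<close>
  have "root_reflection b b = - b"
    using assms(1,3)
    by (auto simp: root_reflection_def cartan_int_def root_system_def scaleR_2)
  then have "- b \<in> R" using assms(1,3) unfolding root_system_def by metis
  with k assms(3) have "c \<in> R" "c \<bullet> c = b \<bullet> b" by (auto simp: c_def)
  then show ?thesis
    using positive_root_length[OF assms(1,2), of k] unfolding c_def by simp
qed

section \<open>Length ratios along the Dynkin diagram\<close>

text \<open>Squared lengths of the simple roots, relative to the short ones.\<close>

fun length_weight :: "dynkin_type \<Rightarrow> nat \<Rightarrow> nat" where
  "length_weight (TypeB n) i = (if i < n then 2 else 1)"
| "length_weight (TypeC n) i = (if i < n then 1 else 2)"
| "length_weight TypeF4 i = (if i \<le> 2 then 2 else 1)"
| "length_weight _ i = 1"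

lemma dynkin_bond_less: "dynkin_valid T \<Longrightarrow> dynkin_bond T i j \<Longrightarrow> i < j"
  by (cases T) (auto simp: bond_E_def)

text \<open>The weights symmetrize the Cartan matrix, just as the true squared lengths do. Nonzero
  entries then let the two be compared by division.\<close>

lemma bond_entry_length_weight:
  assumes "dynkin_valid T" "T \<noteq> TypeG2" "dynkin_bond T i j" "j \<le> dynkin_rank T"
  shows "bond_entry T i j * int (length_weight T j) = bond_entry T j i * int (length_weight T i)"
    "bond_entry T i j \<noteq> 0"
  using assms by (cases T; force) (cases T; simp)

text \<open>Connectedness of the diagram, phrased for an arbitrary \<open>g\<close> that is constant
  along bonds; \<open>g\<close> will be the squared length divided by its weight.\<close>

lemma dynkin_bond_connected:
  assumes T: "dynkin_valid T" and n: "n = dynkin_rank T"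
    and bond: "\<And>i j. 1 \<le> i \<Longrightarrow> j \<le> n \<Longrightarrow> dynkin_bond T i j \<Longrightarrow> g i = g j"
    and i: "i \<in> {1..n}"
  shows "g i = g n"
proof -
  have chain: "g k = g m" if "\<And>i. k \<le> i \<Longrightarrow> i < m \<Longrightarrow> g i = g (Suc i)" "k \<le> m" for k m
    using that(2,1) by (induction rule: dec_induct) auto
  \<comment> \<open>Types A, B, C, F4 and G2.\<close>
  have path: ?thesis if "\<And>i j. dynkin_bond T i j \<longleftrightarrow> j = Suc i"
    by (rule chain) (use that bond i in auto)
  have branch: ?thesis if E: "\<And>i j. dynkin_bond T i j \<longleftrightarrow> bond_E i j" and "n \<ge> 4"
  proof -
    \<comment> \<open>In type E the nodes 3, ..., n form a chain, with node 1 attached at 3 and node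
      2 at 4.\<close>
    have ends: "g 1 = g 3" "g 2 = g 4"
      using E \<open>n \<ge> 4\<close> bond[of 1 3] bond[of 2 4] by (simp_all add: bond_E_def)
    have "g m = g (Suc m)" if "3 \<le> m" "m < n" for m
      by (rule bond) (use that in \<open>simp_all add: E bond_E_def\<close>)
    then have tail: "g k = g n" if "3 \<le> k" "k \<le> n" for k
      by (rule chain) (use that in simp_all)
    have "g 3 = g n" "g 4 = g n" using tail[of 3] tail[of 4] \<open>n \<ge> 4\<close> by auto
    moreover have "i = 1 \<or> i = 2 \<or> g i = g n" using tail[of i] i by (cases "3 \<le> i") auto
    ultimately show ?thesis using ends by metis
  qed
  show ?thesis
  proof (cases T)
    case (TypeD m)
    then have m: "m = n" "n \<ge> 3" using T n by auto
    \<comment> \<open>In type D the nodes 1, ..., n - 1 form a chain, and node n is attached at n -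
      2.\<close>
    have last: "g (n - 2) = g n" using bond[of "n - 2" n] TypeD m by auto
    have below: "g k = g (n - 1)" if "1 \<le> k" "k \<le> n - 1" for k
      by (rule chain, rule bond) (use that TypeD m in auto)
    have "g (n - 2) = g (n - 1)" using below[of "n - 2"] m by auto
    then show ?thesis using last below[of i] i by (cases "i = n") auto
  qed (use path branch n in simp_all)
qed

section \<open>The bound on Cartan integers and the resulting flatness\<close>

lemma cartan_int_root_le_2:
  fixes R X :: "'a::euclidean_space set"
  assumes type: "root_system_of_type T X R" "T \<noteq> TypeG2" and ab: "a \<in> R" "b \<in> R"
  shows "cartan_int a b \<le> 2"
proof -
  define n where "n = dynkin_rank T"
  obtain \<alpha> where T: "dynkin_valid T" and R: "root_system X R" and B: "base_of X R n \<alpha>"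
    and C: "\<And>i j. i \<in> {1..n} \<Longrightarrow> j \<in> {1..n} \<Longrightarrow>
      cartan_int (\<alpha> i) (\<alpha> j) = of_int (cartan_matrix T i j)"
    using type(1) unfolding root_system_of_type_def n_def by blast
  define g where "g i = (\<alpha> i \<bullet> \<alpha> i) / real (length_weight T i)" for i
  have w: "length_weight T i = 1 \<or> length_weight T i = 2" for i by (cases T) auto
  have pos: "0 < v \<bullet> v" if "v \<in> R" for v using R that by (auto simp: root_system_def)
  have bond: "g i = g j" if ij: "1 \<le> i" "j \<le> n" "dynkin_bond T i j" for i j
  proof -
    have mem: "i \<in> {1..n}" "j \<in> {1..n}" and "i \<noteq> j"
      using dynkin_bond_less[OF T ij(3)] ij by auto
    then have "\<alpha> i \<in> R" "\<alpha> j \<in> R" using B by (auto simp: base_of_def)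
    note p = pos[OF this(1)] pos[OF this(2)]
    let ?e = "real_of_int (bond_entry T i j)" and ?e' = "real_of_int (bond_entry T j i)"
    have "cartan_int (\<alpha> i) (\<alpha> j) = ?e" "cartan_int (\<alpha> j) (\<alpha> i) = ?e'"
      using C mem \<open>i \<noteq> j\<close> ij(3) by (auto simp: cartan_matrix_def)
    \<comment> \<open>Both sides equal \<open>2 * (\<alpha> i \<bullet> \<alpha> j)\<close>.\<close>
    then have e: "?e * (\<alpha> j \<bullet> \<alpha> j) = ?e' * (\<alpha> i \<bullet> \<alpha> i)"
      using p by (auto simp: cartan_int_def inner_commute field_simps)
    note bw = bond_entry_length_weight[OF T type(2) ij(3) ij(2)[unfolded n_def]]
    have ew: "?e * real (length_weight T j) = ?e' * real (length_weight T i)"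
      using arg_cong[OF bw(1), of real_of_int] by simp
    have "?e \<noteq> 0" using bw(2) by simp
    moreover have "?e' \<noteq> 0" using e p \<open>?e \<noteq> 0\<close> by auto
    moreover have wp: "real (length_weight T i) > 0" "real (length_weight T j) > 0"
      using w[of i] w[of j] by auto
    ultimately have "(?e * (\<alpha> j \<bullet> \<alpha> j)) / (?e * real (length_weight T j))
        = (?e' * (\<alpha> i \<bullet> \<alpha> i)) / (?e' * real (length_weight T i))"
      using e ew by simp
    then show ?thesis using \<open>?e \<noteq> 0\<close> \<open>?e' \<noteq> 0\<close> by (simp add: g_def)
  qed
  have lengths: "v \<bullet> v = g n \<or> v \<bullet> v = 2 * g n" if v: "v \<in> R" for v
  proof -
    obtain i where i: "i \<in> {1..n}" "v \<bullet> v = \<alpha> i \<bullet> \<alpha> i"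
      using root_length_simple[OF R B v] by blast
    have "g i = g n" by (rule dynkin_bond_connected[OF T n_def bond i(1)])
    then show ?thesis using w[of i] i(2) by (auto simp: g_def)
  qed
  have "a \<bullet> a \<le> 2 * (b \<bullet> b)"
    using lengths[OF ab(1)] lengths[OF ab(2)] pos[OF ab(1)] pos[OF ab(2)] by linarith
  then have "(a \<bullet> a) * (b \<bullet> b) \<le> 2 * (b \<bullet> b) * (b \<bullet> b)"
    using pos[OF ab(2)] by (intro mult_right_mono) auto
  with Cauchy_Schwarz_ineq[of a b] have cs: "(a \<bullet> b)\<^sup>2 \<le> 2 * (b \<bullet> b)\<^sup>2"
    by (simp add: power2_eq_square)
  \<comment> \<open>A value of at least 3 would give
    \<open>9 * (b \<bullet> b)^2 \<le> 8 * (b \<bullet> b)^2\<close>; integrality then improves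
    \<open>< 3\<close> to \<open>\<le> 2\<close>.\<close>
  have "cartan_int a b < 3"
  proof (rule ccontr)
    assume "\<not> cartan_int a b < 3"
    then have "3 * (b \<bullet> b) \<le> 2 * (a \<bullet> b)"
      using pos[OF ab(2)] by (simp add: cartan_int_def field_simps)
    then have "(3 * (b \<bullet> b))\<^sup>2 \<le> (2 * (a \<bullet> b))\<^sup>2"
      using pos[OF ab(2)] by (intro power_mono) auto
    then have "9 * (b \<bullet> b)\<^sup>2 \<le> 4 * (a \<bullet> b)\<^sup>2" by (simp add: power_mult_distrib)
    with cs have "(b \<bullet> b)\<^sup>2 \<le> 0" by linarith
    with pos[OF ab(2)] show False by simp
  qed
  moreover have "cartan_int a b \<in> \<int>" using R ab by (simp add: root_system_def)
  ultimately show ?thesis by (auto elim!: Ints_cases)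
qed

theorem theorem3:
  fixes T :: dynkin_type and X R S G :: "'a::euclidean_space set"
  assumes "root_system_of_type T X R"
    and "T \<noteq> TypeG2"
    and "G = root_lattice R"
    and "S \<subseteq> R"
    and "uminus ` S = S"
  shows "ricci_flat G (cayley_adj G S)"
proof -
  have R: "finite R" "0 \<notin> R"
    using assms(1) by (auto simp: root_system_of_type_def root_system_def)
  have G: "G = group_closure R" using assms(3) by (simp add: root_lattice_def)
  interpret abelian_cayley G S
    by standard
      (use assms(4,5) R finite_subset[OF assms(4)] in
        \<open>auto simp: G intro: group_closure_add group_closure.diff group_closure.base\<close>)
  show ?thesis
  proof (rule ricci_flat_if_lipschitz)
    fix s assume s: "s \<in> S"
    then have "s \<noteq> 0" using zero_notin_gens by blast
    \<comment> \<open>The quotient is half of \<open>cartan_int t s\<close>.\<close>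
    moreover have "(t \<bullet> s) / (s \<bullet> s) \<le> 1" if "t \<in> S" for t
      using cartan_int_root_le_2[OF assms(1,2), of t s] s that assms(4)
      by (auto simp: cartan_int_def simp flip: times_divide_eq_right)
    ultimately show "\<exists>f :: 'a \<Rightarrow> real.
        (\<forall>a b. f (a + b) = f a + f b) \<and> (\<forall>t\<in>S. f t \<le> 1) \<and> f s = 1"
      by (intro exI[of _ "\<lambda>v. (v \<bullet> s) / (s \<bullet> s)"])
         (simp add: inner_add_left add_divide_distrib)
  qed
qed

end
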